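(* Let $X$ be a set. Let $\mathcal{A}\subseteq\mathcal{P}(X)$ be a union closed family of subsets of $X$, and let $\gamma:\mathcal{A}\to[0,\infty]$ be a monotone set function, i.e. if $A,A'\in\mathcal{A}$ and $A\subseteq A'$ then $\gamma(A)\leq\gamma(A')$. Let $\mathcal{B}\subseteq\mathcal{A}$ be a subfamily with the property that for every (infinite) sequence $(B_n)_{n\ge 1}$ of pairwise disjoint members of $\mathcal{B}$ with $\inf_n\gamma(B_n)>0$ we have $\gamma(\bigcup_{n=1}^\infty B_n)=\infty$. Let $\mathcal{C}\subseteq\mathcal{B}$ be a subfamily with $\sup_{C\in\mathcal{C}}\gamma(C)<\infty$ and such that $\gamma(C)\neq0$ for every $C\in\mathcal{C}$. For $\lambda\geq1$ define $\Delta^\lambda_{\gamma,\mathcal{C}}:\mathcal{C}\to\mathcal{P}(X)$ by $$\Delta^\lambda_{\gamma,\mathcal{C}}(C):=\bigcup_{G\in\mathcal{C},\;G\cap C\neq\emptyset,\;\gamma(G)\leq\lambda\gamma(C)}G.$$ (a) For every $\lambda>1$ there is a (finite or infinite) countable sequence $(C^\lambda_n)_n$ of pairwise disjoint members of $\mathcal{C}$ such that: if $\gamma(\bigcup_{C\in\mathcal{C}}C)<\infty$, then $$\bigcup_{C\in\mathcal{C}}C\subseteq\bigcup_n\Delta^\lambda_{\gamma,\mathcal{C}}(C^\lambda_n);\qquad( * )$$ and if $\gamma(\bigcup_{C\in\mathcal{C}}C)=\infty$, then either $\inf_n\gamma(C^\lambda_n)>0$ or the inclusion $( * )$ is satisfied.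 (b) Suppose moreover that for every nonempty subfamily $\mathcal{G}\subseteq\mathcal{C}$ the maximum of the set $\{\gamma(G):G\in\mathcal{G}\}$ of real numbers exists. Then there exists a (finite or infinite) countable sequence $(C^1_n)_n$ of pairwise disjoint members of $\mathcal{C}$ such that: if $\gamma(\bigcup_{C\in\mathcal{C}}C)<\infty$, then $$\bigcup_{C\in\mathcal{C}}C\subseteq\bigcup_n\Delta^1_{\gamma,\mathcal{C}}(C^1_n);\qquad( ** )$$ and if $\gamma(\bigcup_{C\in\mathcal{C}}C)=\infty$, then either $\inf_n\gamma(C^1_n)>0$ or the inclusion $( ** )$ is satisfied.
   Context: $\mathcal{P}(X)$ denotes the power set of $X$. "Union closed" means that the union of any subfamily of $\mathcal{A}$ belongs to $\mathcal{A}$. *)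

theory Defs
  imports "HOL-Analysis.Analysis"
begin

text \<open>Arbitrary subfamilies are meant: uncountable ones, and also the empty one, so that
  \<^term>\<open>{}\<close> is a member of every union closed family.\<close>

definition union_closed :: "'a set set \<Rightarrow> bool" where
  "union_closed \<A> \<longleftrightarrow> (\<forall>\<S>. \<S> \<subseteq> \<A> \<longrightarrow> \<Union>\<S> \<in> \<A>)"

definition Delta :: "real \<Rightarrow> ('a set \<Rightarrow> ennreal) \<Rightarrow> 'a set set \<Rightarrow> 'a set \<Rightarrow> 'a set" where
  "Delta lam \<gamma> \<C> C = \<Union>{G \<in> \<C>. G \<inter> C \<noteq> {} \<and> \<gamma> G \<le> ennreal lam * \<gamma> C}"

text \<open>A finite or infinite sequence is a function on \<^typ>\<open>nat\<close> restricted to the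
  index set \<open>indices N\<close>, where \<open>N\<close> is its length; the empty sequence (\<open>N = 0\<close>) is allowed.\<close>

definition indices :: "enat \<Rightarrow> nat set" where
  "indices N = {n. enat n < N}"

end

theory Submission
  imports Defs
begin

text \<open>Greedy selection, as in Vitali's covering lemma: the next set is chosen disjoint from the
  previous ones and, up to the factor \<open>lam\<close>, of maximal \<open>\<gamma>\<close> among all such sets. A member of
  \<open>\<C>\<close> that meets a selected set lies in \<open>Delta\<close> of the first one it meets. A member \<open>G\<close> that
  meets none forces the sequence to be infinite with \<open>\<gamma> \<ge> \<gamma> G / lam\<close> throughout, and then
  the hypothesis on \<open>\<B>\<close> gives \<open>\<gamma> (\<Union>\<C>) = \<infinity>\<close>.\<close>

lemma greedy_disjoint_selection:
  fixes \<C> :: "'a set set" and P :: "'a set \<Rightarrow> 'a set \<Rightarrow> bool"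
  assumes dominant: "\<And>\<G>. \<G> \<subseteq> \<C> \<Longrightarrow> \<G> \<noteq> {} \<Longrightarrow> \<exists>M\<in>\<G>. \<forall>G\<in>\<G>. P G M"
  obtains c N where "c ` indices N \<subseteq> \<C>" "disjoint_family_on c (indices N)"
    "\<forall>G\<in>\<C>. (\<exists>n\<in>indices N. G \<inter> c n \<noteq> {} \<and> P G (c n)) \<or> (N = \<infinity> \<and> (\<forall>n. P G (c n)))"
proof -
  define rem where "rem D = {G \<in> \<C>. \<forall>E\<in>D. G \<inter> E = {}}" for D
  obtain pick where pick: "\<And>\<G>. \<G> \<subseteq> \<C> \<Longrightarrow> \<G> \<noteq> {} \<Longrightarrow> pick \<G> \<in> \<G> \<and> (\<forall>G\<in>\<G>. P G (pick \<G>))"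
    using dominant by metis
  \<comment> \<open>Each choice depends on all earlier ones. Recursing on the set \<open>S n\<close>
    of the first \<open>n\<close> choices keeps this primitive recursion. The recursion never stops:
    once no candidate remains, \<open>pick\<close> is applied to the empty family and returns an
    unspecified set.\<close>
  define S where "S = rec_nat {} (\<lambda>_ D. insert (pick (rem D)) D)"
  define c where "c n = pick (rem (S n))" for n
  define R where "R n = {G \<in> \<C>. \<forall>i<n. G \<inter> c i = {}}" for n
  have "S n = c ` {..<n}" for n
    by (induction n) (auto simp: S_def c_def lessThan_Suc)
  then have R: "rem (S n) = R n" for n
    by (auto simp: R_def rem_def)
  have R_subset: "R n \<subseteq> \<C>" for n
    by (auto simp: R_def)
  have c: "c n \<in> R n" "\<And>G. G \<in> R n \<Longrightarrow> P G (c n)" if "R n \<noteq> {}" for n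
    using pick[OF R_subset that] by (simp_all add: c_def R)
  \<comment> \<open>Take the least \<open>i\<close> with \<open>G\<close> meeting
    \<open>c i\<close>. By minimality \<open>G\<close> avoids all earlier choices, so it was still a
    candidate when \<open>c i\<close> was picked and is dominated by it.\<close>
  have meets_first: "\<exists>i<n. G \<inter> c i \<noteq> {} \<and> G \<in> R i" if "G \<in> \<C>" "G \<notin> R n" for G n
  proof -
    have "\<exists>i. i < n \<and> G \<inter> c i \<noteq> {}"
      using that by (auto simp: R_def)
    then obtain i where "i < n" "G \<inter> c i \<noteq> {}" "\<And>j. j < i \<Longrightarrow> \<not> (j < n \<and> G \<inter> c j \<noteq> {})"
      unfolding exists_least_iff[of "\<lambda>i. i < n \<and> G \<inter> c i \<noteq> {}"] by blast
    moreover from this have "G \<in> R i"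
      using that(1) by (auto simp: R_def dest: less_trans)
    ultimately show ?thesis
      by blast
  qed
  \<comment> \<open>The length is the first stage without candidates, which cuts off exactly the
    unspecified values of \<open>c\<close>.\<close>
  define N where "N = (if \<exists>n. R n = {} then enat (LEAST n. R n = {}) else \<infinity>)"
  have nonempty: "R n \<noteq> {}" if "n \<in> indices N" for n
    using that not_less_Least[of n "\<lambda>n. R n = {}"]
    by (auto simp: N_def indices_def split: if_splits)
  have "c ` indices N \<subseteq> \<C>"
    using c(1) nonempty by (auto simp: R_def)
  moreover have "disjoint_family_on c (indices N)"
  proof -
    have "c n \<inter> c m = {}" if "n \<in> indices N" "m < n" for m n
      using c(1)[OF nonempty[OF that(1)]] that(2) by (auto simp: R_def)
    then show ?thesis
      unfolding disjoint_family_on_def by (metis inf_commute linorder_neqE_nat)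
  qed
  \<comment> \<open>Stage \<open>N\<close> itself is included in the case split: for finite
    \<open>N\<close> the family \<open>R N\<close> is empty, so every \<open>G\<close> has dropped
    out by then, and the set it first meets has index below \<open>N\<close>. A \<open>G\<close>
    that never drops out therefore forces \<open>N = \<infinity>\<close> and is a candidate at every
    stage.\<close>
  moreover have "(\<exists>n\<in>indices N. G \<inter> c n \<noteq> {} \<and> P G (c n)) \<or> (N = \<infinity> \<and> (\<forall>n. P G (c n)))"
    if "G \<in> \<C>" for G
  proof (cases "\<exists>n. enat n \<le> N \<and> G \<notin> R n")
    case True
    then obtain n where n: "enat n \<le> N" "G \<notin> R n"
      by blast
    from meets_first[OF that n(2)] obtain i where i: "i < n" "G \<inter> c i \<noteq> {}" "G \<in> R i"
      by blast
    then have "i \<in> indices N"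
      using n(1) order_less_le_trans[of "enat i" "enat n" N] by (simp add: indices_def)
    then show ?thesis
      using i c(2) by blast
  next
    case False
    have "\<nexists>n. R n = {}"
    proof
      assume *: "\<exists>n. R n = {}"
      then have "R (LEAST n. R n = {}) = {}"
        by (rule LeastI_ex)
      with * False show False
        by (auto simp: N_def)
    qed
    then show ?thesis
      using False c(2) by (auto simp: N_def)
  qed
  ultimately show ?thesis
    by (intro that ballI)
qed

text \<open>If no \<open>M\<close> works, then each \<open>lam * \<gamma> M\<close> lies below some
  \<open>\<gamma> G\<close>, hence below the supremum \<open>s\<close>. Thus
  \<open>lam * s \<le> s\<close> with \<open>lam > 1\<close>, which leaves only \<open>s = 0\<close>
  for finite \<open>s\<close>.\<close>

lemma near_supremum:
  fixes \<gamma> :: "'b \<Rightarrow> ennreal"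
  assumes "lam > 1" and "\<G> \<noteq> {}" and "(SUP G\<in>\<G>. \<gamma> G) < \<infinity>" and "\<And>G. G \<in> \<G> \<Longrightarrow> \<gamma> G \<noteq> 0"
  shows "\<exists>M\<in>\<G>. \<forall>G\<in>\<G>. \<gamma> G \<le> ennreal lam * \<gamma> M"
proof (rule ccontr)
  assume "\<not> ?thesis"
  then have small: "ennreal lam * \<gamma> M \<le> (SUP G\<in>\<G>. \<gamma> G)" if "M \<in> \<G>" for M
    using that by (meson SUP_upper2 linorder_not_le order_less_imp_le)
  \<comment> \<open>Passing to a real number excludes the solution \<open>\<infinity>\<close> of
    \<open>lam * s \<le> s\<close>.\<close>
  obtain s where s: "(SUP G\<in>\<G>. \<gamma> G) = ennreal s" "s \<ge> 0"
    using assms(3) by (cases "SUP G\<in>\<G>. \<gamma> G") auto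
  have "ennreal lam * (SUP G\<in>\<G>. \<gamma> G) \<le> (SUP G\<in>\<G>. \<gamma> G)"
    using small by (simp add: SUP_mult_left_ennreal SUP_least)
  then have "lam * s \<le> s"
    using s assms(1) by (simp flip: ennreal_mult)
  then have "s = 0"
    using s(2) assms(1) by (auto simp: mult_le_cancel_right2)
  then have "\<gamma> G = 0" if "G \<in> \<G>" for G
    using s(1) SUP_upper[OF that, of \<gamma>] by simp
  then show False
    using assms(2,4) by blast
qed

text \<open>The common core of (a) and (b), which differ only in how \<open>dominant\<close> is
  obtained.\<close>

lemma disjoint_sequence_Delta_cover:
  fixes \<A> \<B> \<C> :: "'a set set" and \<gamma> :: "'a set \<Rightarrow> ennreal"
  assumes "lam > 0" and "union_closed \<A>" and "mono_on \<A> \<gamma>" and "\<B> \<subseteq> \<A>"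
    and blowup: "\<And>B :: nat \<Rightarrow> 'a set. range B \<subseteq> \<B> \<Longrightarrow> disjoint_family B \<Longrightarrow> (INF n. \<gamma> (B n)) > 0
           \<Longrightarrow> \<gamma> (\<Union>n. B n) = \<infinity>"
    and "\<C> \<subseteq> \<B>" and nonzero: "\<And>C. C \<in> \<C> \<Longrightarrow> \<gamma> C \<noteq> 0"
    and dominant: "\<And>\<G>. \<G> \<subseteq> \<C> \<Longrightarrow> \<G> \<noteq> {} \<Longrightarrow> \<exists>M\<in>\<G>. \<forall>G\<in>\<G>. \<gamma> G \<le> ennreal lam * \<gamma> M"
  shows "\<exists>(N :: enat) (c :: nat \<Rightarrow> 'a set).
            c ` indices N \<subseteq> \<C> \<and> disjoint_family_on c (indices N) \<and>
            (\<gamma> (\<Union>\<C>) < \<infinity> \<longrightarrow> \<Union>\<C> \<subseteq> (\<Union>n\<in>indices N. Delta lam \<gamma> \<C> (c n))) \<and>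
            (\<gamma> (\<Union>\<C>) = \<infinity> \<longrightarrow>
               (INF n\<in>indices N. \<gamma> (c n)) > 0 \<or>
               \<Union>\<C> \<subseteq> (\<Union>n\<in>indices N. Delta lam \<gamma> \<C> (c n)))"
proof -
  obtain c N where c: "c ` indices N \<subseteq> \<C>" "disjoint_family_on c (indices N)"
    and meets: "\<forall>G\<in>\<C>. (\<exists>n\<in>indices N. G \<inter> c n \<noteq> {} \<and> \<gamma> G \<le> ennreal lam * \<gamma> (c n)) \<or>
      (N = \<infinity> \<and> (\<forall>n. \<gamma> G \<le> ennreal lam * \<gamma> (c n)))"
    using dominant
    by (rule greedy_disjoint_selection[where P = "\<lambda>G M. \<gamma> G \<le> ennreal lam * \<gamma> M"])
  \<comment> \<open>This one disjunction yields both implications: a finite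
    \<open>\<gamma> (\<Union>\<C>)\<close> rules out the second alternative.\<close>
  have "\<Union>\<C> \<subseteq> (\<Union>n\<in>indices N. Delta lam \<gamma> \<C> (c n)) \<or>
    (INF n\<in>indices N. \<gamma> (c n)) > 0 \<and> \<gamma> (\<Union>\<C>) = \<infinity>"
  proof (cases "\<forall>G\<in>\<C>. \<exists>n\<in>indices N. G \<inter> c n \<noteq> {} \<and> \<gamma> G \<le> ennreal lam * \<gamma> (c n)")
    case True
    then have "\<Union>\<C> \<subseteq> (\<Union>n\<in>indices N. Delta lam \<gamma> \<C> (c n))"
      unfolding Delta_def by blast
    then show ?thesis ..
  next
    case False
    then obtain G where G: "G \<in> \<C>" "N = \<infinity>" "\<And>n. \<gamma> G \<le> ennreal lam * \<gamma> (c n)"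
      using meets by blast
    then have all: "indices N = UNIV"
      by (simp add: indices_def)
    \<comment> \<open>The uncovered set \<open>G\<close> bounds all \<open>\<gamma> (c n)\<close>
      below by \<open>\<gamma> G / ennreal lam\<close>, positive because \<open>\<gamma> G\<close>
      is nonzero and \<open>lam\<close> is finite.\<close>
    have "0 < \<gamma> G / ennreal lam"
      using nonzero[OF G(1)] by (simp add: ennreal_zero_less_divide zero_less_iff_neq_zero)
    also have "\<dots> \<le> (INF n. \<gamma> (c n))"
      using G(3) assms(1) by (intro INF_greatest divide_le_posI_ennreal) auto
    finally have pos: "(INF n. \<gamma> (c n)) > 0" .
    have "range c \<subseteq> \<C>" and "disjoint_family c"
      using c all by simp_all
    then have "\<infinity> = \<gamma> (\<Union>n. c n)"
      using blowup[OF _ _ pos] assms(6) by auto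
    also have "\<dots> \<le> \<gamma> (\<Union>\<C>)"
    \<comment> \<open>Monotonicity is only available on \<open>\<A>\<close>; closure under arbitrary
      unions puts both sets there, even for uncountable \<open>\<C>\<close>.\<close>
    proof (rule mono_onD[OF assms(3)])
      have "\<C> \<subseteq> \<A>" "range c \<subseteq> \<A>"
        using \<open>range c \<subseteq> \<C>\<close> assms(4,6) by auto
      then show "(\<Union>n. c n) \<in> \<A>" "\<Union>\<C> \<in> \<A>"
        using assms(2) by (simp_all add: union_closed_def)
      show "(\<Union>n. c n) \<subseteq> \<Union>\<C>"
        using \<open>range c \<subseteq> \<C>\<close> by blast
    qed
    finally show ?thesis
      using pos all by (simp add: top_unique)
  qed
  then show ?thesis
    using c by (intro exI[of _ N] exI[of _ c]) auto
qed

theorem lemma3: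
  fixes X :: "'a set"
    and \<A> \<B> \<C> :: "'a set set"
    and \<gamma> :: "'a set \<Rightarrow> ennreal"
  assumes "\<A> \<subseteq> Pow X"
    and "union_closed \<A>"
    and "mono_on \<A> \<gamma>"
    and "\<B> \<subseteq> \<A>"
    and "\<And>B :: nat \<Rightarrow> 'a set. range B \<subseteq> \<B> \<Longrightarrow> disjoint_family B \<Longrightarrow> (INF n. \<gamma> (B n)) > 0
           \<Longrightarrow> \<gamma> (\<Union>n. B n) = \<infinity>"
    and "\<C> \<subseteq> \<B>"
    and "(SUP C\<in>\<C>. \<gamma> C) < \<infinity>"
    and "\<And>C. C \<in> \<C> \<Longrightarrow> \<gamma> C \<noteq> 0"
  shows "(\<forall>lam>1. \<exists>(N :: enat) (c :: nat \<Rightarrow> 'a set).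
            c ` indices N \<subseteq> \<C> \<and> disjoint_family_on c (indices N) \<and>
            (\<gamma> (\<Union>\<C>) < \<infinity> \<longrightarrow> \<Union>\<C> \<subseteq> (\<Union>n\<in>indices N. Delta lam \<gamma> \<C> (c n))) \<and>
            (\<gamma> (\<Union>\<C>) = \<infinity> \<longrightarrow>
               (INF n\<in>indices N. \<gamma> (c n)) > 0 \<or>
               \<Union>\<C> \<subseteq> (\<Union>n\<in>indices N. Delta lam \<gamma> \<C> (c n)))) \<and>
         ((\<forall>\<G>. \<G> \<subseteq> \<C> \<and> \<G> \<noteq> {} \<longrightarrow> (\<exists>m\<in>\<gamma> ` \<G>. \<forall>x\<in>\<gamma> ` \<G>. x \<le> m)) \<longrightarrow>
          (\<exists>(N :: enat) (c :: nat \<Rightarrow> 'a set).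
            c ` indices N \<subseteq> \<C> \<and> disjoint_family_on c (indices N) \<and>
            (\<gamma> (\<Union>\<C>) < \<infinity> \<longrightarrow> \<Union>\<C> \<subseteq> (\<Union>n\<in>indices N. Delta 1 \<gamma> \<C> (c n))) \<and>
            (\<gamma> (\<Union>\<C>) = \<infinity> \<longrightarrow>
               (INF n\<in>indices N. \<gamma> (c n)) > 0 \<or>
               \<Union>\<C> \<subseteq> (\<Union>n\<in>indices N. Delta 1 \<gamma> \<C> (c n)))))"
proof (intro conjI allI impI)
  fix lam :: real
  assume lam: "lam > 1"
  show "\<exists>N c. c ` indices N \<subseteq> \<C> \<and> disjoint_family_on c (indices N) \<and>
            (\<gamma> (\<Union>\<C>) < \<infinity> \<longrightarrow> \<Union>\<C> \<subseteq> (\<Union>n\<in>indices N. Delta lam \<gamma> \<C> (c n))) \<and>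
            (\<gamma> (\<Union>\<C>) = \<infinity> \<longrightarrow>
               (INF n\<in>indices N. \<gamma> (c n)) > 0 \<or>
               \<Union>\<C> \<subseteq> (\<Union>n\<in>indices N. Delta lam \<gamma> \<C> (c n)))"
  proof (rule disjoint_sequence_Delta_cover[where \<A> = \<A> and \<B> = \<B>])
    \<comment> \<open>For (a), a subfamily inherits the finite supremum and the nonzero values from
      \<open>\<C>\<close>, so a member within the factor \<open>lam\<close> of its supremum
      exists.\<close>
    show "\<exists>M\<in>\<G>. \<forall>G\<in>\<G>. \<gamma> G \<le> ennreal lam * \<gamma> M" if "\<G> \<subseteq> \<C>" "\<G> \<noteq> {}" for \<G>
    proof (rule near_supremum[OF lam that(2)])
      show "(SUP G\<in>\<G>. \<gamma> G) < \<infinity>"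
        using SUP_subset_mono[OF that(1) order_refl, of \<gamma>] assms(7) by (rule order_le_less_trans)
      show "\<gamma> G \<noteq> 0" if "G \<in> \<G>" for G
        using assms(8)[OF subsetD[OF \<open>\<G> \<subseteq> \<C>\<close> that]] .
    qed
  qed (use lam in simp, (fact assms)+)
next
  assume max: "\<forall>\<G>. \<G> \<subseteq> \<C> \<and> \<G> \<noteq> {} \<longrightarrow> (\<exists>m\<in>\<gamma> ` \<G>. \<forall>x\<in>\<gamma> ` \<G>. x \<le> m)"
  show "\<exists>N c. c ` indices N \<subseteq> \<C> \<and> disjoint_family_on c (indices N) \<and>
            (\<gamma> (\<Union>\<C>) < \<infinity> \<longrightarrow> \<Union>\<C> \<subseteq> (\<Union>n\<in>indices N. Delta 1 \<gamma> \<C> (c n))) \<and>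
            (\<gamma> (\<Union>\<C>) = \<infinity> \<longrightarrow>
               (INF n\<in>indices N. \<gamma> (c n)) > 0 \<or>
               \<Union>\<C> \<subseteq> (\<Union>n\<in>indices N. Delta 1 \<gamma> \<C> (c n)))"
  proof (rule disjoint_sequence_Delta_cover[where \<A> = \<A> and \<B> = \<B>])
    \<comment> \<open>For (b), a member attaining the maximum dominates with factor exactly
      1.\<close>
    show "\<exists>M\<in>\<G>. \<forall>G\<in>\<G>. \<gamma> G \<le> ennreal 1 * \<gamma> M" if "\<G> \<subseteq> \<C>" "\<G> \<noteq> {}" for \<G>
      using max[rule_format, OF conjI[OF that]] by simp
  qed (simp, (fact assms)+)
qed

end
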